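(* Let $p$ be a prime, let $K$ be a finite extension of $\mathbb{Q}_p$, and let $\mathfrak{p}$ be the unique maximal ideal of $\mathcal{O}_K$. For every $x \in K$ the following hold. (1) If $\nu_{\mathfrak{p}}(\nu_{\mathfrak{p}}(x)) \geq 0$ or $\nu_{\mathfrak{p}}(x) \in \{0, +\infty\}$, then the $\nu_{\mathfrak{p}}$ sequence of $x$ is eventually periodic of period $\leq p$. (2) If $\nu_{\mathfrak{p}}(\nu_{\mathfrak{p}}(x)) < 0$, then the $\nu_{\mathfrak{p}}$ sequence of $x$ converges to $-\infty$. (3) The $\nu_{\mathfrak{p}}$ sequence of $x$ is eventually $+\infty$ if and only if $\nu_{\mathfrak{p}}(x) \in \{0, 1, \ldots, p-1, +\infty\}$.
   Context: $\nu_{\mathfrak{p}}: K \to \mathbb{Q}\cup\{+\infty\}$ denotes the unique discrete valuation on $K$ extending the $p$-adic valuation $\nu_p$ of $\mathbb{Q}_p$ (so $\nu_{\mathfrak{p}}(p)=1$ and $\nu_{\mathfrak{p}}(K^\times) = \frac{1}{e}\mathbb{Z}$, $e$ the ramification index). For a rational number $r$, $\nu_{\mathfrak{p}}(r)=\nu_p(r)$, with $\nu_{\mathfrak{p}}(0)=+\infty$. The arithmetic partial derivative $D_{K,\mathfrak{p}}: K \to K$ is defined by $D_{K,\mathfrak{p}}(x) = x\,\nu_{\mathfrak{p}}(x)/p$ for $x \neq 0$ and $D_{K,\mathfrak{p}}(0) = 0$. The $\nu_{\mathfrak{p}}$ sequence of $x$ is the sequence $\nu_{\mathfrak{p}}(x),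 \nu_{\mathfrak{p}}(D_{K,\mathfrak{p}}(x)), \nu_{\mathfrak{p}}(D_{K,\mathfrak{p}}^2(x)), \ldots$, where $D_{K,\mathfrak{p}}^i$ denotes the $i$-th iterate. *)

theory Defs
  imports
    "HOL-Algebra.Embedded_Algebras"
    "HOL-Algebra.QuotRing"
    "HOL-Library.Extended"
    "HOL-Computational_Algebra.Primes"
begin

text \<open>
  Valuations take values in \<open>rat extended\<close>. Its element \<open>Minf\<close> is never a value: a discrete
  valuation is \<open>Pinf\<close> at zero and finite elsewhere.
\<close>

definition rat_val :: "nat \<Rightarrow> rat \<Rightarrow> rat extended" where
  "rat_val p r =
     (if r = 0 then Pinf
      else Fin (of_nat (multiplicity (int p) (fst (quotient_of r)))
              - of_nat (multiplicity (int p) (snd (quotient_of r)))))"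

text \<open>
  The field of p-adic numbers is the completion of the rationals for \<^const>\<open>rat_val\<close>: Cauchy
  sequences of rationals modulo null sequences.
\<close>

definition padic_Cauchy :: "nat \<Rightarrow> (nat \<Rightarrow> rat) \<Rightarrow> bool" where
  "padic_Cauchy p X \<longleftrightarrow> (\<forall>B. \<exists>N. \<forall>m\<ge>N. \<forall>n\<ge>N. Fin B \<le> rat_val p (X m - X n))"

definition padic_null :: "nat \<Rightarrow> (nat \<Rightarrow> rat) \<Rightarrow> bool" where
  "padic_null p X \<longleftrightarrow> (\<forall>B. \<exists>N. \<forall>n\<ge>N. Fin B \<le> rat_val p (X n))"

definition Cauchy_ring :: "nat \<Rightarrow> (nat \<Rightarrow> rat) ring" where
  "Cauchy_ring p =
     \<lparr>carrier = {X. padic_Cauchy p X},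
      monoid.mult = (\<lambda>X Y n. X n * Y n), one = (\<lambda>_. 1),
      zero = (\<lambda>_. 0), add = (\<lambda>X Y n. X n + Y n)\<rparr>"

definition Qp :: "nat \<Rightarrow> (nat \<Rightarrow> rat) set ring" where
  "Qp p = Cauchy_ring p Quot {X. padic_null p X}"

text \<open>
  Along a Cauchy sequence that is not null the valuation is eventually constant, and the constant
  depends only on the class of the sequence.
\<close>

definition Qp_val :: "nat \<Rightarrow> (nat \<Rightarrow> rat) set \<Rightarrow> rat extended" where
  "Qp_val p A =
     (if A = \<zero>\<^bsub>Qp p\<^esub> then Pinf
      else (THE w. \<forall>X\<in>A. \<forall>\<^sub>F n in sequentially. rat_val p (X n) = w))"

text \<open>An extension of \<open>\<rat>\<^sub>p\<close> is a field together with an embedding of \<open>\<rat>\<^sub>p\<close>.\<close>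

definition finite_extension_Qp ::
    "nat \<Rightarrow> ('a, 'm) ring_scheme \<Rightarrow> ((nat \<Rightarrow> rat) set \<Rightarrow> 'a) \<Rightarrow> bool" where
  "finite_extension_Qp p K \<iota> \<longleftrightarrow>
     field K \<and> \<iota> \<in> ring_hom (Qp p) K \<and>
     ring.finite_dimension K (\<iota> ` carrier (Qp p)) (carrier K)"

definition discrete_valuation :: "('a, 'm) ring_scheme \<Rightarrow> ('a \<Rightarrow> rat extended) \<Rightarrow> bool" where
  "discrete_valuation K \<nu> \<longleftrightarrow>
     (\<forall>x\<in>carrier K. \<nu> x = Pinf \<longleftrightarrow> x = \<zero>\<^bsub>K\<^esub>) \<and>
     (\<forall>x\<in>carrier K. \<forall>y\<in>carrier K. \<nu> (x \<otimes>\<^bsub>K\<^esub> y) = \<nu> x + \<nu> y) \<and>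
     (\<forall>x\<in>carrier K. \<forall>y\<in>carrier K. min (\<nu> x) (\<nu> y) \<le> \<nu> (x \<oplus>\<^bsub>K\<^esub> y)) \<and>
     (\<exists>c>0. \<nu> ` (carrier K - {\<zero>\<^bsub>K\<^esub>}) = range (\<lambda>k::int. Fin (of_int k * c)))"

definition extends_Qp_val ::
    "nat \<Rightarrow> ((nat \<Rightarrow> rat) set \<Rightarrow> 'a) \<Rightarrow> ('a \<Rightarrow> rat extended) \<Rightarrow> bool" where
  "extends_Qp_val p \<iota> \<nu> \<longleftrightarrow> (\<forall>A\<in>carrier (Qp p). \<nu> (\<iota> A) = Qp_val p A)"

text \<open>The rational number \<open>r\<close> as an element of a field of characteristic zero.\<close>

definition rat_in :: "('a, 'm) ring_scheme \<Rightarrow> rat \<Rightarrow> 'a" where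
  "rat_in K r = ([fst (quotient_of r)] \<cdot>\<^bsub>K\<^esub> \<one>\<^bsub>K\<^esub>) \<otimes>\<^bsub>K\<^esub> inv\<^bsub>K\<^esub> ([snd (quotient_of r)] \<cdot>\<^bsub>K\<^esub> \<one>\<^bsub>K\<^esub>)"

text \<open>For a valuation \<open>\<nu>\<close> the second case below is exactly \<open>x = 0\<close>.\<close>

definition arith_deriv ::
    "nat \<Rightarrow> ('a, 'm) ring_scheme \<Rightarrow> ('a \<Rightarrow> rat extended) \<Rightarrow> 'a \<Rightarrow> 'a" where
  "arith_deriv p K \<nu> x =
     (case \<nu> x of Fin r \<Rightarrow> x \<otimes>\<^bsub>K\<^esub> rat_in K (r / of_nat p) | _ \<Rightarrow> \<zero>\<^bsub>K\<^esub>)"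

definition val_seq ::
    "nat \<Rightarrow> ('a, 'm) ring_scheme \<Rightarrow> ('a \<Rightarrow> rat extended) \<Rightarrow> 'a \<Rightarrow> nat \<Rightarrow> rat extended" where
  "val_seq p K \<nu> x i = \<nu> ((arith_deriv p K \<nu> ^^ i) x)"

definition eventually_periodic_le :: "nat \<Rightarrow> (nat \<Rightarrow> 'b) \<Rightarrow> bool" where
  "eventually_periodic_le b s \<longleftrightarrow>
     (\<exists>t. 1 \<le> t \<and> t \<le> b \<and> (\<forall>\<^sub>F n in sequentially. s (n + t) = s n))"

definition converges_to_Minf :: "(nat \<Rightarrow> rat extended) \<Rightarrow> bool" where
  "converges_to_Minf s \<longleftrightarrow> (\<forall>B. \<forall>\<^sub>F n in sequentially. s n < Fin B)"

end

theory Submission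
  imports Defs
begin

text \<open>
  On a rational \<open>r\<close> the valuation \<open>\<nu>\<close> is the \<open>p\<close>-adic one, so with \<open>v = \<nu> x \<noteq> 0\<close> finite the derivative
  replaces \<open>v\<close> by \<open>v + ord v - 1\<close>, and it sends \<open>v = 0\<close> to the absorbing value \<open>\<infinity>\<close>. If \<open>ord v < 0\<close>, the
  order never changes because \<open>v\<close> only moves by integers, and \<open>v\<close> decreases by a constant. If
  \<open>ord v = 0\<close>, then \<open>v\<close> decreases by \<open>1\<close> until it is divisible by \<open>p\<close>; it hits \<open>0\<close> exactly when it
  started in \<open>{1..p-1}\<close>. If \<open>ord v = k \<ge> 1\<close>, then \<open>v\<close> jumps up to \<open>v + k - 1\<close> and descends to the next
  value divisible by \<open>p\<close>: this is \<open>v\<close> itself after \<open>k\<close> steps when \<open>k \<le> p\<close>, and otherwise \<open>v + n\<close> with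
  \<open>n\<close> the largest multiple of \<open>p\<close> below \<open>k\<close>, where the order \<open>ord n < n < k\<close> is smaller but still
  positive.
\<close>

section \<open>The \<open>p\<close>-adic order of rational numbers\<close>

definition padic_ord :: "nat \<Rightarrow> rat \<Rightarrow> int" where
  "padic_ord p r = int (multiplicity (int p) (fst (quotient_of r)))
                 - int (multiplicity (int p) (snd (quotient_of r)))"

text \<open>\<open>padic_ord p 0\<close> has the default value 0, while the true order of 0 is
  infinite; hence the separate disjunct.\<close>

definition ord_ge :: "nat \<Rightarrow> int \<Rightarrow> rat \<Rightarrow> bool" where
  "ord_ge p k r \<longleftrightarrow> r = 0 \<or> k \<le> padic_ord p r"

lemma rat_val_padic_ord:
  "rat_val p r = (if r = 0 then Pinf else Fin (of_int (padic_ord p r)))"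
  by (simp add: rat_val_def padic_ord_def)

lemma rat_val_ge_iff: "Fin (of_int k) \<le> rat_val p r \<longleftrightarrow> ord_ge p k r"
  by (simp add: rat_val_padic_ord ord_ge_def)

lemma ord_ge_mono: "ord_ge p k x \<Longrightarrow> j \<le> k \<Longrightarrow> ord_ge p j x"
  by (auto simp: ord_ge_def)

lemma rat_as_fraction:
  fixes r :: rat
  obtains a b :: int where "r = of_int a / of_int b" "b > 0" "coprime a b"
proof -
  obtain a b where q: "quotient_of r = (a, b)" by (cases "quotient_of r")
  show thesis
    by (rule that[OF quotient_of_div[OF q] quotient_of_denom_pos[OF q] quotient_of_coprime[OF q]])
qed

context
  fixes p :: nat
  assumes prime_p: "Factorial_Ring.prime p"
begin

lemma prime_elem_int_p: "prime_elem (int p)"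
  using prime_p by auto

text \<open>Cross-multiplying with the reduced fraction and comparing multiplicities shows that any
  representation gives the order. Sums and products can then be computed without reducing.\<close>

lemma padic_ord_fract:
  assumes "a \<noteq> 0" "b \<noteq> 0"
  shows "padic_ord p (of_int a / of_int b)
           = int (multiplicity (int p) a) - int (multiplicity (int p) b)"
proof -
  obtain c d where q: "quotient_of (of_int a / of_int b) = (c, d)"
    by (cases "quotient_of (of_int a / of_int b)")
  have d: "d > 0" using quotient_of_denom_pos[OF q] .
  have e: "(of_int a / of_int b :: rat) = of_int c / of_int d" using quotient_of_div[OF q] .
  have "(of_int (a * d) :: rat) = of_int (c * b)"
    using e d assms by (simp add: field_simps)
  hence ad: "a * d = c * b" by (simp only: of_int_eq_iff)
  hence "c \<noteq> 0" using assms d by auto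
  have "multiplicity (int p) a + multiplicity (int p) d
          = multiplicity (int p) c + multiplicity (int p) b"
    using arg_cong[OF ad, of "multiplicity (int p)"] assms d \<open>c \<noteq> 0\<close>
    by (simp add: prime_elem_multiplicity_mult_distrib[OF prime_elem_int_p])
  thus ?thesis by (simp add: padic_ord_def q)
qed

lemma padic_ord_of_int: "padic_ord p (of_int a) = int (multiplicity (int p) a)"
proof (cases "a = 0")
  case False
  thus ?thesis using padic_ord_fract[of a 1] by simp
qed (simp add: padic_ord_def)

lemma padic_ord_mult:
  assumes "x \<noteq> 0" "y \<noteq> 0"
  shows "padic_ord p (x * y) = padic_ord p x + padic_ord p y"
proof -
  obtain a b where x: "x = of_int a / of_int b" "b > 0" by (rule rat_as_fraction)
  obtain c d where y: "y = of_int c / of_int d" "d > 0" by (rule rat_as_fraction)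
  have nz: "a \<noteq> 0" "b \<noteq> 0" "c \<noteq> 0" "d \<noteq> 0" using assms x y by auto
  have xy: "x * y = of_int (a * c) / of_int (b * d)" by (simp add: x y)
  have "padic_ord p (x * y)
      = int (multiplicity (int p) (a * c)) - int (multiplicity (int p) (b * d))"
    unfolding xy by (rule padic_ord_fract) (use nz in auto)
  moreover have "padic_ord p x = int (multiplicity (int p) a) - int (multiplicity (int p) b)"
    unfolding x(1) by (rule padic_ord_fract) (use nz in auto)
  moreover have "padic_ord p y = int (multiplicity (int p) c) - int (multiplicity (int p) d)"
    unfolding y(1) by (rule padic_ord_fract) (use nz in auto)
  ultimately show ?thesis
    using nz prime_elem_multiplicity_mult_distrib[OF prime_elem_int_p] by simp
qed

lemma padic_ord_minus: "padic_ord p (- x) = padic_ord p x"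
proof (cases "x = 0")
  case False
  have "padic_ord p (- 1) = 0"
    using multiplicity_unit_right[of "- 1 :: int" "int p"] by (simp add: padic_ord_def)
  moreover have "padic_ord p (- 1 * x) = padic_ord p (- 1) + padic_ord p x"
    by (rule padic_ord_mult) (use False in auto)
  ultimately show ?thesis by simp
qed simp

lemma ord_ge_minus: "ord_ge p k (- x) \<longleftrightarrow> ord_ge p k x"
  by (simp add: ord_ge_def padic_ord_minus)

text \<open>The ultrametric inequality: over the common denominator \<open>b * d\<close>, one power
  of \<open>p\<close> divides both terms of the numerator.\<close>

lemma ord_ge_add:
  assumes "ord_ge p k x" "ord_ge p k y"
  shows "ord_ge p k (x + y)"
proof (cases "x = 0 \<or> y = 0 \<or> x + y = 0")
  case True
  thus ?thesis using assms by (auto simp: ord_ge_def)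
next
  case False
  obtain a b where x: "x = of_int a / of_int b" "b > 0" by (rule rat_as_fraction)
  obtain c d where y: "y = of_int c / of_int d" "d > 0" by (rule rat_as_fraction)
  let ?m = "multiplicity (int p)"
  have nz: "a \<noteq> 0" "c \<noteq> 0" using False x y by auto
  have xy: "x + y = of_int (a * d + c * b) / of_int (b * d)"
    using x y by (simp add: field_simps)
  have s: "a * d + c * b \<noteq> 0" 
  proof
    assume "a * d + c * b = 0"
    hence "x + y = 0" by (simp only: xy of_int_0 div_0)
    thus False using False by simp
  qed
  have mult: "?m (u * v) = ?m u + ?m v" if "u \<noteq> 0" "v \<noteq> 0" for u v
    using that by (rule prime_elem_multiplicity_mult_distrib[OF prime_elem_int_p])
  have "k \<le> int (?m a) - int (?m b)" "k \<le> int (?m c) - int (?m d)"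
    using assms False nz x y by (auto simp: ord_ge_def padic_ord_fract)
  hence le: "k + int (?m b) + int (?m d) \<le> int (?m (a * d))"
      "k + int (?m b) + int (?m d) \<le> int (?m (c * b))"
    using nz x y by (simp_all add: mult)
  \<comment> \<open>\<open>nat\<close> turns a negative bound into exponent 0, for which
    divisibility is trivial; \<open>j\<close> is at least the bound in every case.\<close>
  define j where "j = nat (k + int (?m b) + int (?m d))"
  have "int p ^ j dvd a * d + c * b"
    by (rule dvd_add; rule multiplicity_dvd') (use le in \<open>auto simp: j_def\<close>)
  hence "j \<le> ?m (a * d + c * b)"
    using s prime_elem_int_p by (intro multiplicity_geI) auto
  hence "k \<le> int (?m (a * d + c * b)) - int (?m (b * d))"
    using x y by (simp add: mult j_def)
  also have "\<dots> = padic_ord p (x + y)"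
    unfolding xy by (rule padic_ord_fract[symmetric]) (use s x y in auto)
  finally show ?thesis by (simp add: ord_ge_def)
qed

text \<open>The summand of strictly smaller order decides: if \<open>x + y\<close> had larger order
  than \<open>x\<close>, so would \<open>x = (x + y) - y\<close>.\<close>

lemma padic_ord_add_eq:
  assumes "x \<noteq> 0" "ord_ge p (padic_ord p x + 1) y"
  shows "x + y \<noteq> 0" "padic_ord p (x + y) = padic_ord p x"
proof -
  have *: "\<not> ord_ge p (padic_ord p x + 1) (x + y)"
  proof
    assume "ord_ge p (padic_ord p x + 1) (x + y)"
    from ord_ge_add[OF this, of "- y"] assms show False
      by (simp add: ord_ge_minus) (simp add: ord_ge_def)
  qed
  moreover have "ord_ge p (padic_ord p x) (x + y)"
    by (rule ord_ge_add) (use assms in \<open>auto simp: ord_ge_def\<close>)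
  ultimately show "x + y \<noteq> 0" "padic_ord p (x + y) = padic_ord p x"
    by (auto simp: ord_ge_def)
qed

lemma ord_ge_of_int: "ord_ge p 0 (of_int n)"
  by (simp add: ord_ge_def padic_ord_of_int)

text \<open>The \<open>p\<close>-integral rationals have residue field of \<open>p\<close> elements,
  represented by \<open>0, ..., p - 1\<close>.\<close>

lemma ord_ge_residue:
  assumes "ord_ge p 0 r"
  obtains s where "s < p" "ord_ge p 1 (r - of_nat s)"
proof -
  obtain a b where r: "r = of_int a / of_int b" "b > 0" "coprime a b" by (rule rat_as_fraction)
  \<comment> \<open>The fraction is reduced, so a factor \<open>p\<close> in \<open>b\<close> would
    make the order negative.\<close>
  have "\<not> int p dvd b"
  proof
    assume b: "int p dvd b"
    hence na: "\<not> int p dvd a"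
      using r(3) prime_elem_int_p by (meson coprime_common_divisor prime_elem_def)
    hence "a \<noteq> 0" by auto
    moreover have "multiplicity (int p) a = 0"
      using na by (rule not_dvd_imp_multiplicity_0)
    moreover have "multiplicity (int p) b > 0"
      using b r(2) prime_elem_int_p by (simp add: prime_multiplicity_gt_zero_iff)
    ultimately show False using assms r by (auto simp: ord_ge_def padic_ord_fract)
  qed
  hence "coprime (int p) b"
    using prime_p by (simp add: prime_imp_coprime)
  then obtain u v where uv: "u * int p + v * b = 1"
    using bezout_int[of "int p" b] by (auto simp: coprime_iff_gcd_eq_1)
  \<comment> \<open>By the Bezout identity \<open>v\<close> inverts \<open>b\<close> modulo
    \<open>p\<close>, so \<open>s\<close> is the residue of \<open>a / b\<close>.\<close>
  define s where "s = nat ((a * v) mod int p)"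
  have p0: "int p > 0" using prime_p prime_gt_0_nat by auto
  have s: "int s = (a * v) mod int p" using p0 by (simp add: s_def)
  obtain w where w: "a * v = int s + int p * w"
    using mod_mult_div_eq[of "a * v" "int p"] s by metis
  have "a - int s * b = a * (u * int p + v * b) - int s * b" by (simp add: uv)
  also have "\<dots> = a * u * int p + (a * v) * b - int s * b"
    by (simp add: distrib_left mult.assoc)
  also have "\<dots> = int p * (a * u + w * b)"
    unfolding w by (simp add: algebra_simps)
  finally have dvd: "int p ^ 1 dvd a - int s * b" by simp
  define c where "c = a - int s * b"
  have rs: "r - of_nat s = of_int c / of_int b"
    using r(2) by (simp add: r(1) c_def field_simps)
  have "ord_ge p 1 (r - of_nat s)"
  proof (cases "c = 0")
    case True
    thus ?thesis by (simp add: rs ord_ge_def)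
  next
    case False
    have "1 \<le> multiplicity (int p) c"
      by (rule multiplicity_geI) (use dvd False prime_elem_int_p in \<open>auto simp: c_def\<close>)
    moreover have "multiplicity (int p) b = 0"
      using \<open>\<not> int p dvd b\<close> by (rule not_dvd_imp_multiplicity_0)
    ultimately show ?thesis
      using padic_ord_fract[of c b] False r(2) by (simp add: rs ord_ge_def)
  qed
  moreover have "s < p" using pos_mod_bound[OF p0, of "a * v"] s by linarith
  ultimately show ?thesis using that by blast
qed

end

section \<open>The dynamics that the derivative induces on values\<close>

definition val_step :: "nat \<Rightarrow> rat extended \<Rightarrow> rat extended" where
  "val_step p w =
     (case w of Fin r \<Rightarrow> if r = 0 then Pinf else Fin (r + of_int (padic_ord p r) - 1) | _ \<Rightarrow> w)"

lemma val_step_Pinf_iterate: "(val_step p ^^ n) Pinf = Pinf"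
  by (induction n) (simp_all add: val_step_def)

lemma funpow_cycle_multiple: "(f ^^ t) z = z \<Longrightarrow> (f ^^ (t * n)) z = z"
  by (induction n) (simp_all add: funpow_add)

lemma reaches_cycle_imp_eventually_periodic:
  assumes "(f ^^ a) w = z" "(f ^^ t) z = z" "1 \<le> t" "t \<le> b"
  shows "eventually_periodic_le b (\<lambda>n. (f ^^ n) w)"
proof -
  have "(f ^^ (n + t)) w = (f ^^ n) w" if "n \<ge> a" for n
  proof -
    have "n + t = (n - a) + (t + a)" "n = (n - a) + a" using that by auto
    thus ?thesis using assms(1,2) by (metis comp_apply funpow_add)
  qed
  thus ?thesis
    unfolding eventually_periodic_le_def eventually_sequentially using assms(3,4) by blast
qed

text \<open>The finite value \<open>z\<close> recurs at all times \<open>t * N + a\<close>, hence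
  arbitrarily late.\<close>

lemma reaches_cycle_not_eventually_Pinf:
  assumes "(val_step p ^^ a) w = Fin z" "(val_step p ^^ t) (Fin z) = Fin z" "1 \<le> t"
  shows "\<not> (\<forall>\<^sub>F n in sequentially. (val_step p ^^ n) w = Pinf)"
proof
  assume "\<forall>\<^sub>F n in sequentially. (val_step p ^^ n) w = Pinf"
  then obtain N where N: "\<And>n. n \<ge> N \<Longrightarrow> (val_step p ^^ n) w = Pinf"
    by (auto simp: eventually_sequentially)
  have "(val_step p ^^ (t * N + a)) w = Fin z"
    using assms funpow_cycle_multiple[OF assms(2), of N] by (simp add: funpow_add)
  moreover have "t * N + a \<ge> N" using assms(3) by (simp add: trans_le_add1)
  ultimately show False using N by force
qed

context
  fixes p :: nat
  assumes prime_p: "Factorial_Ring.prime p"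
begin

text \<open>With \<open>m\<close> the multiplicity, \<open>m < p ^ m \<le> n\<close>. This makes the
  order drop in the induction that leads to a cycle.\<close>

lemma multiplicity_less_self:
  assumes "n > 0"
  shows "multiplicity (int p) (int n) < n"
proof -
  let ?m = "multiplicity (int p) (int n)"
  have "int p ^ ?m dvd int n" by (rule multiplicity_dvd)
  hence "p ^ ?m dvd n" by (metis of_nat_dvd_iff of_nat_power)
  hence "p ^ ?m \<le> n" using assms by (simp add: dvd_imp_le)
  moreover have "?m < p ^ ?m" 
    using prime_gt_1_nat[OF prime_p] by (intro power_gt_expt) simp
  ultimately show ?thesis by simp
qed

lemma padic_ord_add_small:
  assumes "ord_ge p 1 r" "0 < s" "s < p"
  shows "r + of_nat s \<noteq> 0" "padic_ord p (r + of_nat s) = 0"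
proof -
  have "\<not> int p dvd int s" using assms by (auto dest: zdvd_imp_le)
  hence "multiplicity (int p) (int s) = 0" by (rule not_dvd_imp_multiplicity_0)
  hence "padic_ord p (of_nat s) = 0" using padic_ord_of_int[OF prime_p, of "int s"] by simp
  thus "r + of_nat s \<noteq> 0" "padic_ord p (r + of_nat s) = 0"
    using padic_ord_add_eq[OF prime_p, of "of_nat s" r] assms by (simp_all add: add.commute)
qed

text \<open>Between \<open>r\<close> and \<open>r + p\<close> every value \<open>r + s\<close> has
  order 0, so each step subtracts exactly 1. The case \<open>r = 0\<close> is included and covers
  the sequences that end at infinity.\<close>

lemma val_step_descend:
  assumes "ord_ge p 1 r" "s < p"
  shows "(val_step p ^^ s) (Fin (r + of_nat s)) = Fin r"
  using assms(2)
proof (induction s)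
  case (Suc s)
  have "val_step p (Fin (r + of_nat (Suc s))) = Fin (r + of_nat s)"
    using padic_ord_add_small[OF assms(1), of "Suc s"] Suc.prems by (simp add: val_step_def)
  thus ?case using Suc by (simp add: funpow_swap1 del: of_nat_Suc)
qed simp

text \<open>Strong induction on the order: a jump followed by a descent either returns to
  \<open>r\<close> or lands on a value of smaller positive order.\<close>

lemma val_step_reaches_cycle:
  assumes "r \<noteq> 0" "padic_ord p r \<ge> 1"
  shows "\<exists>a t z. 1 \<le> t \<and> t \<le> p \<and> (val_step p ^^ a) (Fin r) = Fin z
               \<and> (val_step p ^^ t) (Fin z) = Fin z"
  using assms
proof (induction "nat (padic_ord p r)" arbitrary: r rule: less_induct)
  case less
  define k where "k = nat (padic_ord p r)"
  have k: "k \<ge> 1" "padic_ord p r = int k" using less.prems by (auto simp: k_def)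
  have step: "val_step p (Fin r) = Fin (r + of_nat (k - 1))"
    using less.prems k by (simp add: val_step_def of_nat_diff)
  have r: "ord_ge p 1 r" using less.prems by (simp add: ord_ge_def)
  show ?case
  \<comment> \<open>If \<open>k \<le> p\<close>, the jump has length \<open>k - 1 < p\<close>, so
    the descent ends at \<open>r\<close> itself: one step up and \<open>k - 1\<close> down give
    period \<open>k\<close>.\<close>
  proof (cases "k \<le> p")
    case True
    have "(val_step p ^^ (k - 1)) (val_step p (Fin r)) = Fin r"
      unfolding step using r True k by (intro val_step_descend) auto
    hence "(val_step p ^^ k) (Fin r) = Fin r"
      using k(1) by (metis One_nat_def Suc_diff_le diff_Suc_1 funpow_simps_right(2) comp_apply)
    thus ?thesis using True k by (intro exI[of _ 0] exI[of _ k] exI[of _ r]) auto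
  next
    case False
    \<comment> \<open>The jump length \<open>k - 1\<close>, not \<open>k\<close>, is divided by
      \<open>p\<close>: the descent takes \<open>s\<close> steps and stops at \<open>r + n\<close>.
      Since \<open>k > p\<close>, the quotient is positive.\<close>
    define n s where "n = (k - 1) div p * p" and "s = (k - 1) mod p"
    have p0: "p > 0" using prime_p prime_gt_0_nat by blast
    have ns: "k - 1 = n + s" "s < p" using p0 by (auto simp: n_def s_def)
    have "n > 0" using False p0 by (auto simp: n_def div_greater_zero_iff)
    have on: "padic_ord p (of_nat n) = int (multiplicity (int p) (int n))"
      using padic_ord_of_int[OF prime_p, of "int n"] by simp
    have lt: "multiplicity (int p) (int n) < k"
      using multiplicity_less_self[OF \<open>n > 0\<close>] ns k by simp
    have ge: "multiplicity (int p) (int n) \<ge> 1"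
      by (rule multiplicity_geI)
         (use \<open>n > 0\<close> prime_elem_int_p[OF prime_p] in \<open>auto simp: n_def\<close>)
    \<comment> \<open>\<open>n\<close> has smaller order than \<open>r\<close>, so it determines the
      order of \<open>z\<close>; as \<open>p\<close> divides \<open>n\<close>, that order is still
      at least 1.\<close>
    define z where "z = of_nat n + r"
    have z: "z \<noteq> 0" "padic_ord p z = int (multiplicity (int p) (int n))"
      using padic_ord_add_eq[OF prime_p, of "of_nat n" r] \<open>n > 0\<close> on lt k
      by (auto simp: z_def ord_ge_def)
    have "ord_ge p 1 z" using z ge by (simp add: ord_ge_def)
    from val_step_descend[OF this ns(2)]
    have "(val_step p ^^ s) (val_step p (Fin r)) = Fin z"
      unfolding step ns(1) by (simp add: z_def add_ac)
    hence reach: "(val_step p ^^ Suc s) (Fin r) = Fin z" by (simp add: funpow_swap1)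
    have "nat (padic_ord p z) < nat (padic_ord p r)" "padic_ord p z \<ge> 1"
      using z lt ge k by auto
    from less.hyps[OF this(1) z(1) this(2)] obtain a t y where
      "1 \<le> t" "t \<le> p" "(val_step p ^^ a) (Fin z) = Fin y" "(val_step p ^^ t) (Fin y) = Fin y"
      by blast
    moreover from this(3) have "(val_step p ^^ (a + Suc s)) (Fin r) = Fin y"
      unfolding funpow_add comp_apply reach .
    ultimately show ?thesis by blast
  qed
qed

text \<open>The accumulated shift is an integer, of order at least 0, so it cannot change the
  negative order of \<open>r\<close>; every step therefore adds the same constant.\<close>

lemma val_step_iterate_neg:
  assumes "r \<noteq> 0" "padic_ord p r < 0"
  shows "(val_step p ^^ n) (Fin r) = Fin (r + of_nat n * of_int (padic_ord p r - 1))"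
proof (induction n)
  case (Suc n)
  let ?y = "r + of_nat n * of_int (padic_ord p r - 1)"
  have "ord_ge p (padic_ord p r + 1) (of_int (int n * (padic_ord p r - 1)))"
    by (rule ord_ge_mono[OF ord_ge_of_int[OF prime_p]]) (use assms(2) in simp)
  hence "?y \<noteq> 0 \<and> padic_ord p ?y = padic_ord p r"
    using padic_ord_add_eq[OF prime_p assms(1)] by simp
  hence "val_step p (Fin ?y) = Fin (?y + of_int (padic_ord p r) - 1)"
    by (simp add: val_step_def)
  thus ?case by (simp add: Suc algebra_simps)
qed simp

lemma val_step_converges_to_Minf:
  assumes "r \<noteq> 0" "padic_ord p r < 0"
  shows "converges_to_Minf (\<lambda>n. (val_step p ^^ n) (Fin r))"
  unfolding converges_to_Minf_def eventually_sequentially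
proof
  fix B :: rat
  obtain N :: nat where N: "r - B < of_nat N" using reals_Archimedean2 by blast
  have "r + of_nat n * of_int (padic_ord p r - 1) < B" if "n \<ge> N" for n
  proof -
    have "(of_int (padic_ord p r - 1) :: rat) \<le> of_int (- 1)"
      using assms(2) by (subst of_int_le_iff) simp
    hence "of_nat n * of_int (padic_ord p r - 1) \<le> of_nat n * (- 1 :: rat)"
      by (intro mult_left_mono) auto
    moreover have "(of_nat N :: rat) \<le> of_nat n" using that by simp
    ultimately show ?thesis using N by linarith
  qed
  thus "\<exists>N. \<forall>n\<ge>N. (val_step p ^^ n) (Fin r) < Fin B"
    by (auto simp only: val_step_iterate_neg[OF assms] less_extended_simps)
qed

text \<open>\<open>s\<close> steps descend to 0, and the one after that goes to infinity.\<close>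

lemma val_step_of_nat_reaches_Pinf:
  assumes "s < p"
  shows "(val_step p ^^ Suc s) (Fin (of_nat s)) = Pinf"
  using val_step_descend[of 0 s] assms by (simp add: ord_ge_def val_step_def)

text \<open>After as many steps as the residue \<open>s\<close> of \<open>r\<close>, the value is
  \<open>r - s\<close>, which is either 0 or of order at least 1.\<close>

lemma val_step_eventually_periodic:
  assumes "ord_ge p 0 r"
  shows "eventually_periodic_le p (\<lambda>n. (val_step p ^^ n) (Fin r))"
proof -
  obtain s where s: "s < p" "ord_ge p 1 (r - of_nat s)"
    using ord_ge_residue[OF prime_p assms] .
  show ?thesis
  proof (cases "r = of_nat s")
    case True
    show ?thesis
      unfolding True using s(1) prime_p
      \<comment> \<open>\<open>Pinf\<close> is a fixed point, so the period here is 1.\<close>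
      by (intro reaches_cycle_imp_eventually_periodic[where t = 1, OF val_step_of_nat_reaches_Pinf])
         (auto simp: val_step_def)
  next
    case False
    with s(2) obtain a t z where c: "1 \<le> t" "t \<le> p"
      "(val_step p ^^ a) (Fin (r - of_nat s)) = Fin z" "(val_step p ^^ t) (Fin z) = Fin z"
      using val_step_reaches_cycle[of "r - of_nat s"] by (auto simp: ord_ge_def)
    have "(val_step p ^^ (a + s)) (Fin r) = Fin z"
      using val_step_descend[OF s(2,1)] c(3) by (simp add: funpow_add)
    thus ?thesis using c by (intro reaches_cycle_imp_eventually_periodic)
  qed
qed

text \<open>For the forward direction, negative order keeps all iterates finite, and for order at
  least 0 an \<open>r\<close> different from its residue enters a cycle of finite values.\<close>

lemma val_step_eventually_Pinf_iff:
  "(\<forall>\<^sub>F n in sequentially. (val_step p ^^ n) (Fin r) = Pinf) \<longleftrightarrow> (\<exists>s<p. r = of_nat s)"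
proof
  assume "\<exists>s<p. r = of_nat s"
  then obtain s where s: "s < p" "r = of_nat s" by blast
  have "(val_step p ^^ n) (Fin r) = Pinf" if "n \<ge> Suc s" for n
  proof -
    have "n = (n - Suc s) + Suc s" using that by simp
    thus ?thesis
      using val_step_of_nat_reaches_Pinf[OF s(1)] s(2) val_step_Pinf_iterate
      by (metis comp_apply funpow_add)
  qed
  thus "\<forall>\<^sub>F n in sequentially. (val_step p ^^ n) (Fin r) = Pinf"
    unfolding eventually_sequentially by blast
next
  assume ev: "\<forall>\<^sub>F n in sequentially. (val_step p ^^ n) (Fin r) = Pinf"
  have "ord_ge p 0 r"
  proof (rule ccontr)
    assume "\<not> ord_ge p 0 r"
    with ev show False by (auto simp: ord_ge_def val_step_iterate_neg)
  qed
  then obtain s where s: "s < p" "ord_ge p 1 (r - of_nat s)"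
    using ord_ge_residue[OF prime_p] by blast
  have "r = of_nat s"
  proof (rule ccontr)
    assume "r \<noteq> of_nat s"
    with s(2) obtain a t z where c: "1 \<le> t" "t \<le> p"
      "(val_step p ^^ a) (Fin (r - of_nat s)) = Fin z" "(val_step p ^^ t) (Fin z) = Fin z"
      using val_step_reaches_cycle[of "r - of_nat s"] by (auto simp: ord_ge_def)
    have "(val_step p ^^ (a + s)) (Fin r) = Fin z"
      using val_step_descend[OF s(2,1)] c(3) by (simp add: funpow_add)
    from reaches_cycle_not_eventually_Pinf[OF this c(4,1)] ev show False by blast
  qed
  thus "\<exists>s<p. r = of_nat s" using s(1) by blast
qed

end

section \<open>The rational numbers inside \<open>Qp p\<close>, as classes of constant
  sequences\<close>

definition Qp_const :: "nat \<Rightarrow> rat \<Rightarrow> (nat \<Rightarrow> rat) set" where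
  "Qp_const p r = {X. padic_null p (\<lambda>n. X n - r)}"

text \<open>Orders are integers, so a rational bound may be replaced by its ceiling.\<close>

lemma padic_null_iff: "padic_null p X \<longleftrightarrow> (\<forall>k. \<exists>N. \<forall>n\<ge>N. ord_ge p k (X n))"
proof -
  have "Fin B \<le> rat_val p r \<longleftrightarrow> ord_ge p \<lceil>B\<rceil> r" for B r
    by (simp add: rat_val_padic_ord ord_ge_def ceiling_le_iff)
  moreover have "(\<forall>B. Q \<lceil>B :: rat\<rceil>) \<longleftrightarrow> (\<forall>k. Q k)" for Q
    by (metis ceiling_of_int)
  ultimately show ?thesis unfolding padic_null_def by simp
qed

lemma const_in_Qp_const: "(\<lambda>_. r) \<in> Qp_const p r"
  by (simp add: Qp_const_def padic_null_iff ord_ge_def)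

lemma Qp_const_eq_coset: "Qp_const p r = {X. padic_null p X} +>\<^bsub>Cauchy_ring p\<^esub> (\<lambda>_. r)"
proof -
  have "X \<in> {X. padic_null p X} +>\<^bsub>Cauchy_ring p\<^esub> (\<lambda>_. r)" if "X \<in> Qp_const p r" for X
    using that unfolding Qp_const_def a_r_coset_def' Cauchy_ring_def
    by (auto intro!: exI[of _ "\<lambda>n. X n - r"])
  thus ?thesis
    by (auto simp: Qp_const_def a_r_coset_def' Cauchy_ring_def)
qed

lemma Qp_const_in_carrier: "Qp_const p r \<in> carrier (Qp p)"
  by (auto simp: Qp_def FactRing_def A_RCOSETS_def' Qp_const_eq_coset Cauchy_ring_def
      padic_Cauchy_def rat_val_def)

lemma one_Qp: "\<one>\<^bsub>Qp p\<^esub> = Qp_const p 1"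
  by (simp add: Qp_def FactRing_def Qp_const_eq_coset) (simp add: Cauchy_ring_def)

lemma zero_Qp: "\<zero>\<^bsub>Qp p\<^esub> = Qp_const p 0"
  by (simp add: Qp_def FactRing_def Qp_const_def)

context
  fixes p :: nat
  assumes prime_p: "Factorial_Ring.prime p"
begin

lemma padic_null_add:
  assumes "padic_null p X" "padic_null p Y"
  shows "padic_null p (\<lambda>n. X n + Y n)"
  unfolding padic_null_iff
proof
  fix k
  obtain M N where "\<forall>n\<ge>M. ord_ge p k (X n)" "\<forall>n\<ge>N. ord_ge p k (Y n)"
    using assms unfolding padic_null_iff by metis
  hence "\<forall>n\<ge>max M N. ord_ge p k (X n + Y n)"
    using ord_ge_add[OF prime_p] by simp
  thus "\<exists>N. \<forall>n\<ge>N. ord_ge p k (X n + Y n)" ..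
qed

lemma Qp_const_add: "Qp_const p r \<oplus>\<^bsub>Qp p\<^esub> Qp_const p s = Qp_const p (r + s)"
proof -
  have "Qp_const p r \<oplus>\<^bsub>Qp p\<^esub> Qp_const p s
      = {\<lambda>n. X n + Y n | X Y. X \<in> Qp_const p r \<and> Y \<in> Qp_const p s}"
    by (auto simp: Qp_def FactRing_def set_add_def' Cauchy_ring_def)
  also have "\<dots> = Qp_const p (r + s)"
  proof (intro equalityI subsetI)
    fix Z assume "Z \<in> {\<lambda>n. X n + Y n | X Y. X \<in> Qp_const p r \<and> Y \<in> Qp_const p s}"
    then obtain X Y where Z: "Z = (\<lambda>n. X n + Y n)"
      and "padic_null p (\<lambda>n. X n - r)" "padic_null p (\<lambda>n. Y n - s)"
      by (auto simp: Qp_const_def)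
    from padic_null_add[OF this(2,3)] show "Z \<in> Qp_const p (r + s)"
      by (simp add: Z Qp_const_def algebra_simps)
  next
    fix Z assume "Z \<in> Qp_const p (r + s)"
    \<comment> \<open>Addition in the quotient is the sum of sets, so \<open>Z\<close> has to be
      split: the second summand is the constant sequence \<open>s\<close>.\<close>
    hence "(\<lambda>n. Z n - s) \<in> Qp_const p r" by (simp add: Qp_const_def algebra_simps)
    thus "Z \<in> {\<lambda>n. X n + Y n | X Y. X \<in> Qp_const p r \<and> Y \<in> Qp_const p s}"
      using const_in_Qp_const[of s p] by force
  qed
  finally show ?thesis .
qed

text \<open>A sequence in the class of \<open>r\<close> differs from \<open>r\<close> by terms whose
  order eventually exceeds that of \<open>r\<close>, so its valuation is eventually that of
  \<open>r\<close>.\<close>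

lemma Qp_val_const:
  assumes "r \<noteq> 0"
  shows "Qp_val p (Qp_const p r) = rat_val p r"
proof -
  have "(\<lambda>_. r) \<notin> Qp_const p 0"
  proof
    assume "(\<lambda>_. r) \<in> Qp_const p 0"
    hence "ord_ge p (padic_ord p r + 1) r" by (auto simp: Qp_const_def padic_null_iff)
    thus False using assms by (simp add: ord_ge_def)
  qed
  hence nz: "Qp_const p r \<noteq> \<zero>\<^bsub>Qp p\<^esub>"
    using const_in_Qp_const[of r p] by (auto simp: zero_Qp)
  have ev: "\<forall>\<^sub>F n in sequentially. rat_val p (X n) = rat_val p r" if "X \<in> Qp_const p r" for X
  proof -
    obtain N where N: "\<And>n. n \<ge> N \<Longrightarrow> ord_ge p (padic_ord p r + 1) (X n - r)"
      using \<open>X \<in> Qp_const p r\<close> unfolding Qp_const_def padic_null_iff by blast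
    have "rat_val p (X n) = rat_val p r" if "n \<ge> N" for n
      using padic_ord_add_eq[OF prime_p assms N[OF that]] assms by (simp add: rat_val_padic_ord)
    thus ?thesis unfolding eventually_sequentially by blast
  qed
  have "(THE w. \<forall>X\<in>Qp_const p r. \<forall>\<^sub>F n in sequentially. rat_val p (X n) = w) = rat_val p r"
  proof (rule the_equality)
    show "\<forall>X\<in>Qp_const p r. \<forall>\<^sub>F n in sequentially. rat_val p (X n) = rat_val p r"
      using ev by blast
    show "w = rat_val p r"
      if "\<forall>X\<in>Qp_const p r. \<forall>\<^sub>F n in sequentially. rat_val p (X n) = w" for w
      \<comment> \<open>The constant sequence lies in the class and pins down the limit value
        \<open>w\<close>.\<close>
      using bspec[OF that const_in_Qp_const] by (simp add: eventually_const)
  qed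
  thus ?thesis using nz by (simp add: Qp_val_def)
qed

end

section \<open>Valued extensions of \<open>Qp p\<close> and the derivative on them\<close>

locale valued_Qp_extension = field K for K :: "('a, 'm) ring_scheme" (structure) +
  fixes p :: nat and \<iota> :: "(nat \<Rightarrow> rat) set \<Rightarrow> 'a" and \<nu> :: "'a \<Rightarrow> rat extended"
  assumes prime_p: "Factorial_Ring.prime p"
    and hom: "\<iota> \<in> ring_hom (Qp p) K"
    and valuation: "discrete_valuation K \<nu>"
    and extends: "extends_Qp_val p \<iota> \<nu>"
begin

lemma val_Pinf_iff: "x \<in> carrier K \<Longrightarrow> \<nu> x = Pinf \<longleftrightarrow> x = \<zero>"
  by (rule bspec[OF conjunct1[OF valuation[unfolded discrete_valuation_def]]])

lemma val_mult: "x \<in> carrier K \<Longrightarrow> y \<in> carrier K \<Longrightarrow> \<nu> (x \<otimes> y) = \<nu> x + \<nu> y"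
  by (rule bspec[OF bspec[OF conjunct1[OF conjunct2[OF valuation[unfolded discrete_valuation_def]]]]])

text \<open>The description of the value group rules out \<open>Minf\<close> as well as
  \<open>Pinf\<close>.\<close>

lemma val_finite:
  assumes "x \<in> carrier K" "x \<noteq> \<zero>"
  obtains r where "\<nu> x = Fin r"
proof -
  have "\<exists>c>0. \<nu> ` (carrier K - {\<zero>}) = range (\<lambda>k::int. Fin (of_int k * c))"
    using valuation unfolding discrete_valuation_def by (elim conjE)
  then obtain c where "\<nu> ` (carrier K - {\<zero>}) = range (\<lambda>k::int. Fin (of_int k * c))"
    by (elim exE conjE)
  moreover have "\<nu> x \<in> \<nu> ` (carrier K - {\<zero>})" using assms by simp
  ultimately have "\<nu> x \<in> range (\<lambda>k::int. Fin (of_int k * c))" by simp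
  thus ?thesis using that by blast
qed

lemma val_cases:
  assumes "x \<in> carrier K"
  obtains r where "\<nu> x = Fin r" "x \<noteq> \<zero>" | "\<nu> x = Pinf" "x = \<zero>"
  using assms val_finite val_Pinf_iff by blast

lemma val_one: "\<nu> \<one> = 0"
proof -
  obtain r where r: "\<nu> \<one> = Fin r" using val_finite[of \<one>] by auto
  thus ?thesis using val_mult[of \<one> \<one>] by (simp add: zero_extended_def)
qed

text \<open>Minus one squares to one, so twice its finite value is 0.\<close>

lemma val_minus:
  assumes "x \<in> carrier K"
  shows "\<nu> (\<ominus> x) = \<nu> x"
proof -
  obtain r where r: "\<nu> (\<ominus> \<one>) = Fin r" using val_finite[of "\<ominus> \<one>"] by auto
  have "(\<ominus> \<one>) \<otimes> (\<ominus> \<one>) = \<one>" by (simp add: l_minus r_minus)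
  hence "r = 0" using val_mult[of "\<ominus> \<one>" "\<ominus> \<one>"] r val_one by (simp add: zero_extended_def)
  moreover have "\<ominus> x = (\<ominus> \<one>) \<otimes> x" using assms by (simp add: l_minus)
  ultimately show ?thesis
    using val_mult[of "\<ominus> \<one>" x] assms r by (cases "\<nu> x") auto
qed

text \<open>The induction starts at one because \<open>ring_hom\<close> directly provides the images
  of one and of sums, but not that of zero.\<close>

lemma hom_Qp_const_of_nat: "\<iota> (Qp_const p (of_nat (Suc n))) = [Suc n] \<cdot> \<one>"
proof (induction n)
  case 0
  have "\<iota> \<one>\<^bsub>Qp p\<^esub> = \<one>" using hom by (rule ring_hom_one)
  thus ?case by (simp add: one_Qp)
next
  case (Suc n)
  have "Qp_const p (of_nat (Suc (Suc n))) = Qp_const p (of_nat (Suc n)) \<oplus>\<^bsub>Qp p\<^esub> \<one>\<^bsub>Qp p\<^esub>"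
    by (simp only: one_Qp Qp_const_add[OF prime_p]) (simp add: add.commute)
  hence "\<iota> (Qp_const p (of_nat (Suc (Suc n)))) = \<iota> (Qp_const p (of_nat (Suc n))) \<oplus> \<iota> \<one>\<^bsub>Qp p\<^esub>"
    using ring_hom_add[OF hom Qp_const_in_carrier Qp_const_in_carrier] by (simp only: one_Qp)
  also have "\<dots> = [Suc n] \<cdot> \<one> \<oplus> \<one>"
    using Suc ring_hom_one[OF hom] by simp
  finally show ?case by simp
qed

lemma val_of_nat: "\<nu> ([Suc n] \<cdot> \<one>) = rat_val p (of_nat (Suc n))"
  using extends Qp_const_in_carrier Qp_val_const[OF prime_p, of "of_nat (Suc n)"]
  unfolding extends_Qp_val_def hom_Qp_const_of_nat[symmetric]
  by (metis of_nat_eq_0_iff nat.distinct(1))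

text \<open>Positive integers come from \<iota>; for negative ones, neither \<nu> nor the
  multiplicity sees the sign.\<close>

lemma val_of_int:
  assumes "k \<noteq> 0"
  shows "\<nu> ([k] \<cdot> \<one>) = Fin (of_int (int (multiplicity (int p) k)))"
proof -
  have pos: "\<nu> ([n] \<cdot> \<one>) = Fin (of_int (int (multiplicity (int p) (int n))))" if "n > 0" for n :: nat
  proof -
    obtain m where m: "n = Suc m" using \<open>n > 0\<close> by (cases n) auto
    have "\<nu> ([n] \<cdot> \<one>) = rat_val p (of_int (int n))"
      using val_of_nat[of m] by (simp add: m)
    thus ?thesis
      using that by (simp only: rat_val_padic_ord padic_ord_of_int[OF prime_p]) simp
  qed
  show ?thesis
  proof (cases "k > 0")
    case True
    thus ?thesis using pos[of "nat k"] by (simp add: add_pow_int_ge)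
  next
    case False
    have "padic_ord p (of_int (- k)) = padic_ord p (of_int k)"
      using padic_ord_minus[OF prime_p, of "of_int k"] by simp
    hence "multiplicity (int p) (- k) = multiplicity (int p) k"
      by (simp only: padic_ord_of_int[OF prime_p] of_nat_eq_iff)
    thus ?thesis
      using pos[of "nat (- k)"] False assms by (simp add: add_pow_int_lt val_minus)
  qed
qed

text \<open>Characteristic zero, read off from the finite valuation.\<close>

lemma of_int_nonzero:
  fixes k :: int
  shows "k \<noteq> 0 \<Longrightarrow> [k] \<cdot> \<one> \<noteq> \<zero>"
  using val_of_int[of k] val_Pinf_iff[of \<zero>] by auto

lemma rat_in_closed: "rat_in K r \<in> carrier K"
proof -
  have "[snd (quotient_of r)] \<cdot> \<one> \<noteq> \<zero>"
    using quotient_of_denom_pos'[of r] by (intro of_int_nonzero) simp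
  thus ?thesis unfolding rat_in_def by (simp add: field_Units)
qed

lemma val_rat_in: "\<nu> (rat_in K r) = rat_val p r"
proof -
  obtain a b where q: "quotient_of r = (a, b)" by (cases "quotient_of r")
  have b: "b > 0" using quotient_of_denom_pos[OF q] .
  have B: "[b] \<cdot> \<one> \<in> Units K" using of_int_nonzero[of b] b by (simp add: field_Units)
  \<comment> \<open>Clearing the denominator reduces the claim to integers and avoids the valuation
    of an inverse.\<close>
  have mult: "rat_in K r \<otimes> ([b] \<cdot> \<one>) = [a] \<cdot> \<one>"
    using B by (simp add: rat_in_def q m_assoc)
  show ?thesis
  proof (cases "r = 0")
    case True
    hence "a = 0" using q by simp
    hence "rat_in K r = \<zero>" using B by (simp add: rat_in_def q add_pow_int_ge)
    thus ?thesis using True val_Pinf_iff[of \<zero>] by (simp add: rat_val_def)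
  next
    case False
    hence "a \<noteq> 0" using quotient_of_div[OF q] by auto
    hence "\<nu> (rat_in K r) + Fin (of_int (int (multiplicity (int p) b)))
             = Fin (of_int (int (multiplicity (int p) a)))"
      using val_mult[OF rat_in_closed, of "[b] \<cdot> \<one>" r] b mult by (simp add: val_of_int)
    thus ?thesis using False q
      by (cases "\<nu> (rat_in K r)") (auto simp: rat_val_def)
  qed
qed

lemma arith_deriv_closed: "x \<in> carrier K \<Longrightarrow> arith_deriv p K \<nu> x \<in> carrier K"
  by (simp add: arith_deriv_def rat_in_closed split: extended.split)

lemma val_arith_deriv:
  assumes "x \<in> carrier K"
  shows "\<nu> (arith_deriv p K \<nu> x) = val_step p (\<nu> x)"
  using assms
proof (cases rule: val_cases)
  case (1 r)
  have p0: "p > 0" using prime_p prime_gt_0_nat by blast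
  \<comment> \<open>For \<open>r = 0\<close> the second summand is \<open>Pinf\<close> and absorbs
    the first, as in \<open>val_step\<close>; otherwise the division by \<open>p\<close> yields the
    \<open>- 1\<close>.\<close>
  have "\<nu> (arith_deriv p K \<nu> x) = Fin r + rat_val p (r / of_nat p)"
    using 1 assms by (simp add: arith_deriv_def val_mult rat_in_closed val_rat_in)
  moreover have "padic_ord p (r / of_nat p) = padic_ord p r - 1" if "r \<noteq> 0"
  proof -
    have "padic_ord p (of_nat p) = 1"
      using padic_ord_of_int[OF prime_p, of "int p"] prime_elem_int_p[OF prime_p] by simp
    thus ?thesis
      using padic_ord_mult[OF prime_p, of "r / of_nat p" "of_nat p"] that p0 by simp
  qed
  ultimately show ?thesis
    using 1 p0 by (simp add: val_step_def rat_val_padic_ord)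
next
  case 2
  thus ?thesis by (simp add: arith_deriv_def val_step_def)
qed

text \<open>The whole sequence depends on \<open>x\<close> only through \<nu>\<open>x\<close>, so
  the results on \<open>val_step\<close> apply.\<close>

lemma val_seq_eq_iterate:
  assumes "x \<in> carrier K"
  shows "val_seq p K \<nu> x = (\<lambda>n. (val_step p ^^ n) (\<nu> x))"
proof
  fix n
  have "(arith_deriv p K \<nu> ^^ n) x \<in> carrier K
      \<and> \<nu> ((arith_deriv p K \<nu> ^^ n) x) = (val_step p ^^ n) (\<nu> x)"
    by (induction n) (simp_all add: assms arith_deriv_closed val_arith_deriv)
  thus "val_seq p K \<nu> x n = (val_step p ^^ n) (\<nu> x)" by (simp add: val_seq_def)
qed

end

theorem theorem1p3:
  fixes p :: nat
    and K :: "('a, 'm) ring_scheme"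
    and \<iota> :: "(nat \<Rightarrow> rat) set \<Rightarrow> 'a"
    and \<nu> :: "'a \<Rightarrow> rat extended"
    and x :: 'a
  assumes "Factorial_Ring.prime p"
    and "finite_extension_Qp p K \<iota>"
    and "discrete_valuation K \<nu>"
    and "extends_Qp_val p \<iota> \<nu>"
    and "x \<in> carrier K"
  shows "((\<exists>r. \<nu> x = Fin r \<and> \<nu> (rat_in K r) \<ge> 0) \<or> \<nu> x \<in> {0, Pinf} \<longrightarrow>
            eventually_periodic_le p (val_seq p K \<nu> x)) \<and>
         ((\<exists>r. \<nu> x = Fin r \<and> \<nu> (rat_in K r) < 0) \<longrightarrow>
            converges_to_Minf (val_seq p K \<nu> x)) \<and>
         ((\<forall>\<^sub>F n in sequentially. val_seq p K \<nu> x n = Pinf) \<longleftrightarrow>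
            \<nu> x \<in> {Fin (of_nat k) | k. k \<le> p - 1} \<union> {Pinf})"
proof -
  interpret valued_Qp_extension K p \<iota> \<nu>
    using assms by (simp add: valued_Qp_extension_def valued_Qp_extension_axioms_def
        finite_extension_Qp_def)
  have p0: "p \<ge> 1" using assms(1) prime_ge_1_nat by blast
  show ?thesis
  proof (cases rule: val_cases[OF assms(5)])
    case (1 r)
    have seq: "val_seq p K \<nu> x = (\<lambda>n. (val_step p ^^ n) (Fin r))"
      using val_seq_eq_iterate[OF assms(5)] 1 by simp
    have ge: "\<nu> (rat_in K r) \<ge> 0 \<longleftrightarrow> ord_ge p 0 r"
      unfolding val_rat_in zero_extended_def using rat_val_ge_iff[of 0 p r] by simp
    \<comment> \<open>The value 0 has infinite order, so the alternative \<nu>\<open>x = 0\<close>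
      also falls under \<open>ord_ge p 0 r\<close>.\<close>
    have ord0: "ord_ge p 0 r" if "r = 0" using that by (simp add: ord_ge_def)
    have neg: "r \<noteq> 0 \<and> padic_ord p r < 0" if "\<nu> (rat_in K r) < 0"
    proof -
      have "\<not> ord_ge p 0 r" using that ge by (simp add: less_extended_def)
      thus ?thesis by (auto simp: ord_ge_def)
    qed
    have "eventually_periodic_le p (val_seq p K \<nu> x)"
      if "(\<exists>r. \<nu> x = Fin r \<and> \<nu> (rat_in K r) \<ge> 0) \<or> \<nu> x \<in> {0, Pinf}"
      unfolding seq using that 1 ge ord0
      by (intro val_step_eventually_periodic[OF assms(1)]) (auto simp: zero_extended_def)
    moreover have "converges_to_Minf (val_seq p K \<nu> x)"
      if "\<exists>r. \<nu> x = Fin r \<and> \<nu> (rat_in K r) < 0"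
      unfolding seq using that 1 neg
      by (intro val_step_converges_to_Minf[OF assms(1)]) auto
    moreover have "(\<exists>s<p. r = of_nat s) \<longleftrightarrow> \<nu> x \<in> {Fin (of_nat k) | k. k \<le> p - 1} \<union> {Pinf}"
    proof -
      \<comment> \<open>Subtraction is truncated on the naturals; the equivalence relies on
        \<open>p \<ge> 1\<close>.\<close>
      have "s < p \<longleftrightarrow> s \<le> p - 1" for s using p0 by auto
      thus ?thesis using 1 by auto
    qed
    ultimately show ?thesis
      using val_step_eventually_Pinf_iff[OF assms(1), of r] unfolding seq by blast
  next
    case 2
    hence "val_seq p K \<nu> x = (\<lambda>n. Pinf)"
      using val_seq_eq_iterate[OF assms(5)] val_step_Pinf_iterate by simp
    moreover have "eventually_periodic_le p (\<lambda>n. Pinf :: rat extended)"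
      unfolding eventually_periodic_le_def using p0 by auto
    ultimately show ?thesis using 2 by simp
  qed
qed

end
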